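(* Let $\alpha$ be a nonnegative integer and let $p_1,\dots,p_{\alpha+1}$ be primes with $p_i\geq 5$ for $1\leq i\leq \alpha+1$. If $p_{\alpha+1}\equiv 3 \pmod 4$ and $j$ is an integer with $j\not\equiv 0\pmod{p_{\alpha+1}}$, then for all integers $n\geq 0$ we have $$b_6\left( p_1^2\cdots p_{\alpha+1}^2\,n+\frac{p_1^2\cdots p_\alpha^2\,p_{\alpha+1}(24j+5p_{\alpha+1})-5}{24}\right)\equiv 0 \pmod 3.$$
   Context: A partition is called $6$-regular if none of its parts is divisible by $6$. $b_6(n)$ denotes the number of $6$-regular partitions of $n$, with $b_6(0)=1$ and $b_6(n)=0$ for $n<0$. When $\alpha=0$, the empty product $p_1^2\cdots p_\alpha^2$ equals $1$. The primes $p_i$ are not assumed distinct. *)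

theory Defs
  imports "HOL-Number_Theory.Number_Theory" "HOL-Library.Multiset"
begin

text \<open>Partitions of n are represented as finite multisets of positive integers with sum n.\<close>

definition regular_partitions :: "nat \<Rightarrow> nat \<Rightarrow> nat multiset set" where
  "regular_partitions l n =
     {M. (\<forall>k\<in>#M. k > 0) \<and> \<Sum>\<^sub># M = n \<and> (\<forall>k\<in>#M. \<not> l dvd k)}"

definition b6 :: "int \<Rightarrow> nat" where
  "b6 n = (if n < 0 then 0 else card (regular_partitions 6 (nat n)))"

lemma finite_regular_partitions: "finite (regular_partitions l n)"
proof (rule finite_subset)
  show "regular_partitions l n \<subseteq> mset ` {xs. set xs \<subseteq> {..n} \<and> length xs \<le> n}"
  proof
    fix M assume M: "M \<in> regular_partitions l n"
    have pos: "\<forall>k\<in>#M. k > 0" and s: "\<Sum>\<^sub># M = n"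
      using M by (auto simp: regular_partitions_def)
    obtain xs where xs: "M = mset xs" by (metis ex_mset)
    have "set xs \<subseteq> {..n}"
      using s unfolding xs by (auto simp: sum_mset_sum_list intro: member_le_sum_list)
    moreover have "(\<forall>k\<in>set ys. k > 0) \<Longrightarrow> length ys \<le> sum_list ys" for ys :: "nat list"
      by (induction ys) auto
    ultimately show "M \<in> mset ` {xs. set xs \<subseteq> {..n} \<and> length xs \<le> n}"
      using pos s xs by (auto simp: sum_mset_sum_list)
  qed
  show "finite (mset ` {xs. set xs \<subseteq> {..n} \<and> length xs \<le> n})"
    by (intro finite_imageI finite_lists_length_le) auto
qed

lemma b6_0: "b6 0 = 1"
proof -
  have "regular_partitions 6 0 = {{#}}"
    by (auto simp: regular_partitions_def) (metis less_irrefl multiset_nonemptyE)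
  then show ?thesis by (simp add: b6_def)
qed

lemma prime_square_cong_24:
  fixes p :: int
  assumes "prime p" "p \<ge> 5"
  shows "[p\<^sup>2 = 1] (mod 24)"
proof -
  have "\<not> 2 dvd p" "\<not> 3 dvd p"
    using assms primes_dvd_imp_eq[of 2 p] primes_dvd_imp_eq[of 3 p] by auto
  then have "p mod 24 \<in> {1, 5, 7, 11, 13, 17, 19, 23}"
    by (simp add: insert_iff) presburger
  moreover have "p\<^sup>2 mod 24 = (p mod 24)\<^sup>2 mod 24"
    by (simp add: power_mod)
  ultimately show ?thesis by (auto simp: cong_def)
qed

text \<open>The division by 24 occurring in the main congruence is exact.\<close>

lemma dvd_24_argument:
  fixes p :: "nat \<Rightarrow> int" and j :: int
  assumes "\<And>i. i \<in> {1..\<alpha> + 1} \<Longrightarrow> prime (p i) \<and> p i \<ge> 5"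
  shows "24 dvd (\<Prod>i = 1..\<alpha>. (p i)\<^sup>2) * p (\<alpha> + 1) * (24 * j + 5 * p (\<alpha> + 1)) - 5"
proof -
  let ?P = "\<Prod>i = 1..\<alpha>. (p i)\<^sup>2" and ?q = "p (\<alpha> + 1)"
  have "[?P = (\<Prod>i = 1..\<alpha>. 1)] (mod 24)"
    by (intro cong_prod prime_square_cong_24) (use assms in auto)
  moreover have "[?q\<^sup>2 = 1] (mod 24)"
    using assms[of "\<alpha> + 1"] by (intro prime_square_cong_24) auto
  ultimately have "[?P * ?q\<^sup>2 = 1 * 1] (mod 24)"
    by (intro cong_mult) auto
  then have "24 dvd ?P * ?q\<^sup>2 - 1" by (simp add: cong_iff_dvd_diff)
  then have "24 dvd 24 * (?P * ?q * j) + 5 * (?P * ?q\<^sup>2 - 1)"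
    by (intro dvd_add dvd_triv_left dvd_mult)
  also have "24 * (?P * ?q * j) + 5 * (?P * ?q\<^sup>2 - 1) = ?P * ?q * (24 * j + 5 * ?q) - 5"
    by (simp add: algebra_simps power2_eq_square)
  finally show ?thesis .
qed

end

theory Submission
  imports Defs "HOL-Computational_Algebra.Formal_Power_Series"
begin

text \<open>
  Write $f_k(q) = \prod_{i \ge 1} (1 - q^{ki})$. The generating function of $b_6$ is $f_6 / f_1$,
  which is congruent to $f_2^3 / f_1$ modulo 3, and $f_2^3(q) = f_1(q) f_1(-q) f_4(q)$. Hence it is
  congruent to $f_1(-q) f_1(q^4)$, and by Euler's pentagonal number theorem $b_6(n)$ is divisible
  by 3 unless $24n + 5 = (6k+1)^2 + (2(6l+1))^2$ for some integers $k, l$. For the arguments $n$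
  of the theorem the prime $p_{\alpha+1}$, which is 3 modulo 4, divides $24n + 5$ to an odd power,
  so $24n + 5$ is not a sum of two squares.
\<close>

section \<open>Partitions with parts in a given set\<close>

definition partitions_in :: "nat set \<Rightarrow> nat \<Rightarrow> nat multiset set" where
  "partitions_in S n = {M. set_mset M \<subseteq> S \<and> \<Sum>\<^sub># M = n}"

definition partitions_fps :: "nat set \<Rightarrow> int fps" where
  "partitions_fps S = Abs_fps (\<lambda>n. int (card (partitions_in S n)))"

lemma finite_partitions_in:
  assumes "0 \<notin> S"
  shows "finite (partitions_in S n)"
proof (rule finite_subset)
  \<comment> \<open>Since 0 divides only 0, \<open>regular_partitions 0 n\<close> consists of all
    partitions of \<open>n\<close> into positive parts.\<close>
  show "partitions_in S n \<subseteq> regular_partitions 0 n"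
    using assms by (auto simp: partitions_in_def regular_partitions_def intro: gr0I)
qed (rule finite_regular_partitions)

text \<open>Split by whether \<open>k\<close> occurs. If it does, one copy is removed and others may
  remain, hence \<open>insert k S\<close> on both sides. Counted, this is the recurrence behind
  multiplication by \<open>1 - X^k\<close>.\<close>

lemma partitions_in_insert:
  assumes "k \<notin> S"
  shows "partitions_in (insert k S) n =
    partitions_in S n \<union> (if n < k then {} else add_mset k ` partitions_in (insert k S) (n - k))"
    (is "?L = ?R")
proof
  show "?L \<subseteq> ?R"
  proof
    fix M assume M: "M \<in> ?L"
    show "M \<in> ?R"
    proof (cases "k \<in># M")
      case True
      then obtain M' where "M = add_mset k M'" by (metis mset_add)
      then show ?thesis using M by (auto simp: partitions_in_def)
    next
      case False
      then show ?thesis using M by (auto simp: partitions_in_def)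
    qed
  qed
  show "?R \<subseteq> ?L" by (auto simp: partitions_in_def split: if_splits)
qed

lemma card_partitions_in_insert:
  assumes "k \<notin> S" "0 \<notin> S" "k > 0"
  shows "card (partitions_in (insert k S) n) =
    card (partitions_in S n) + (if n < k then 0 else card (partitions_in (insert k S) (n - k)))"
proof (cases "n < k")
  case True
  then show ?thesis using partitions_in_insert[OF assms(1), of n] by simp
next
  case False
  let ?I = "add_mset k ` partitions_in (insert k S) (n - k)"
  have "k \<notin># M" if "M \<in> partitions_in S n" for M
    using that assms(1) by (auto simp: partitions_in_def)
  moreover have "k \<in># M" if "M \<in> ?I" for M
    using that by auto
  ultimately have "partitions_in S n \<inter> ?I = {}" by blast
  moreover have "partitions_in (insert k S) n = partitions_in S n \<union> ?I"
    by (subst partitions_in_insert[OF assms(1)]) (simp only: False if_False)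
  moreover have "finite (partitions_in S n)" "finite ?I"
    using assms by (simp_all add: finite_partitions_in)
  ultimately have "card (partitions_in (insert k S) n) = card (partitions_in S n) + card ?I"
    by (simp only: card_Un_disjoint)
  also have "card ?I = card (partitions_in (insert k S) (n - k))"
    by (rule card_image) (simp add: inj_on_def)
  finally show ?thesis using False by simp
qed

text \<open>Euler's product for partitions, put as an inverse relation so that no division of series
  is needed. Each new part size \<open>k\<close> contributes one geometric series.\<close>

lemma partitions_fps_mult:
  assumes "finite S" "0 \<notin> S"
  shows "partitions_fps S * (\<Prod>k\<in>S. 1 - fps_X ^ k) = 1"
  using assms
proof (induction S)
  case empty
  have "partitions_in {} n = (if n = 0 then {{#}} else {})" for n
    by (auto simp: partitions_in_def)
  then show ?case by (auto simp: partitions_fps_def fps_eq_iff)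
next
  case (insert k S)
  have "partitions_fps (insert k S) * (1 - fps_X ^ k) = partitions_fps S"
    using insert.hyps insert.prems
    by (auto simp: fps_eq_iff right_diff_distrib fps_X_power_mult_right_nth partitions_fps_def
        card_partitions_in_insert)
  then show ?case using insert by (simp flip: mult.assoc)
qed

section \<open>Congruence of truncated power series\<close>

text \<open>Working modulo \<open>X^(N+1)\<close> lets finite products stand for the infinite
  products $f_k$.\<close>

definition fps_cong :: "nat \<Rightarrow> int \<Rightarrow> int fps \<Rightarrow> int fps \<Rightarrow> bool" where
  "fps_cong N m f g \<longleftrightarrow> (\<forall>n\<le>N. [fps_nth f n = fps_nth g n] (mod m))"

lemma fps_cong_refl: "fps_cong N m f f"
  by (simp add: fps_cong_def)

lemma fps_cong_sym: "fps_cong N m f g \<Longrightarrow> fps_cong N m g f"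
  by (simp add: fps_cong_def cong_sym)

lemma fps_cong_trans [trans]: "fps_cong N m f g \<Longrightarrow> fps_cong N m g h \<Longrightarrow> fps_cong N m f h"
  unfolding fps_cong_def by (blast intro: cong_trans)

lemma fps_cong_mult:
  "fps_cong N m f f' \<Longrightarrow> fps_cong N m g g' \<Longrightarrow> fps_cong N m (f * g) (f' * g')"
  by (auto simp: fps_cong_def fps_mult_nth intro!: cong_sum cong_mult)

lemma fps_cong_prod:
  "(\<And>i. i \<in> S \<Longrightarrow> fps_cong N m (f i) (g i)) \<Longrightarrow> fps_cong N m (prod f S) (prod g S)"
  by (induction S rule: infinite_finite_induct) (auto intro: fps_cong_mult fps_cong_refl)

text \<open>A factor with index above \<open>N\<close> is 1 modulo \<open>X^(N+1)\<close>, so only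
  the indices up to \<open>N\<close> matter.\<close>

lemma fps_cong_prod_one_minus:
  assumes "finite S" "finite T" "\<And>i. i \<le> N \<Longrightarrow> i \<in> S \<longleftrightarrow> i \<in> T"
  shows "fps_cong N m (\<Prod>i\<in>S. 1 - fps_X ^ i) (\<Prod>i\<in>T. 1 - fps_X ^ i)"
proof -
  have *: "fps_cong N m (\<Prod>i\<in>R. 1 - fps_X ^ i) (\<Prod>i\<in>R \<inter> {..N}. 1 - fps_X ^ i)"
    if "finite R" for R
  proof -
    have "fps_cong N m (\<Prod>i\<in>R. 1 - fps_X ^ i) (\<Prod>i\<in>R. if i \<in> {..N} then 1 - fps_X ^ i else 1)"
      by (rule fps_cong_prod) (auto simp: fps_cong_def)
    then show ?thesis using that by (simp add: prod.inter_restrict)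
  qed
  have "S \<inter> {..N} = T \<inter> {..N}" using assms(3) by auto
  then have "fps_cong N m (\<Prod>i\<in>T. 1 - fps_X ^ i) (\<Prod>i\<in>S \<inter> {..N}. 1 - fps_X ^ i)"
    using *[OF assms(2)] by (simp only:)
  then show ?thesis by (rule fps_cong_trans[OF *[OF assms(1)] fps_cong_sym])
qed

lemma fps_cong_cube_one_minus:
  "fps_cong N 3 ((1 - fps_X ^ k) ^ 3) (1 - fps_X ^ (3 * k))"
proof -
  have "(1 - y) ^ 3 = 1 - y ^ 3 + 3 * (y * y - y)" for y :: "int fps"
    by (simp add: power3_eq_cube algebra_simps)
  from this[of "fps_X ^ k"]
  \<comment> \<open>Writing 3 as \<open>fps_const 3\<close> makes the factor 3 visible in every
    coefficient.\<close>
  have "(1 - fps_X ^ k) ^ 3 = 1 - fps_X ^ (3 * k) + fps_const 3 * (fps_X ^ k * fps_X ^ k - fps_X ^ k :: int fps)"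
    by (simp only: power_mult[symmetric] mult.commute[of k] numeral_fps_const)
  then show ?thesis
    by (simp only: fps_cong_def cong_iff_dvd_diff) simp
qed

section \<open>Euler's pentagonal number theorem\<close>

text \<open>The generalised pentagonal numbers, indexed by all integers. As
  \<open>k * (3 * k + 1)\<close> is always even and nonnegative, neither \<open>div\<close> nor
  \<open>nat\<close> loses anything.\<close>

definition pentagonal :: "int \<Rightarrow> nat" where
  "pentagonal k = nat (k * (3 * k + 1) div 2)"

text \<open>Completing the square removes \<open>nat\<close> and \<open>div\<close>, and later turns
  pentagonal exponents into squares.\<close>

lemma pentagonal_eq: "24 * int (pentagonal k) + 1 = (6 * k + 1)\<^sup>2"
proof -
  have "even (k * (3 * k + 1))" by auto
  moreover have "k * (3 * k + 1) \<ge> 0"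
    by (cases "k \<ge> 0") (auto simp: zero_le_mult_iff)
  ultimately have "2 * int (pentagonal k) = k * (3 * k + 1)"
    by (simp add: pentagonal_def)
  then show ?thesis by (simp add: power2_eq_square algebra_simps)
qed

text \<open>The right-hand side is the exponent of \<open>q\<close> in
  \<open>shanks_term q n n\<close>.\<close>

lemma pentagonal_of_nat: "pentagonal (int n) = n * n + n * (n + 1) div 2"
proof -
  have "2 * (n * (n + 1) div 2) = n * (n + 1)" by simp
  then have "2 * int (n * (n + 1) div 2) = int n * (int n + 1)"
    by (metis of_nat_1 of_nat_add of_nat_mult of_nat_numeral)
  then have "24 * int (pentagonal (int n)) = 24 * int (n * n + n * (n + 1) div 2)"
    using pentagonal_eq[of "int n"] by (simp add: power2_eq_square algebra_simps)
  then show ?thesis by (metis mult_cancel_left of_nat_eq_iff zero_neq_numeral)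
qed

lemma pentagonal_minus: "pentagonal (int n) = pentagonal (- int n) + n"
  using pentagonal_eq[of "int n"] pentagonal_eq[of "- int n"]
  by (simp add: power2_eq_square algebra_simps)

text \<open>
  Shanks' finite form of the theorem: the sum of these terms over $s \le n$ is exactly the
  truncated pentagonal series, while modulo $q^{n+1}$ only the term for $s = 0$, the product
  $\prod_{i \le n} (1 - q^i)$, survives.
\<close>

definition shanks_term :: "'a::comm_ring_1 \<Rightarrow> nat \<Rightarrow> nat \<Rightarrow> 'a" where
  "shanks_term q n s = (-1) ^ s * (\<Prod>i\<in>{s<..n}. 1 - q ^ i) * q ^ (s * n + s * (s + 1) div 2)"

text \<open>The difference is arranged to telescope in $s$.\<close>

lemma shanks_term_diff:
  fixes q :: "'a::comm_ring_1"
  defines "U \<equiv> \<lambda>n s. shanks_term q n s * q ^ (s + n + 1)"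
  assumes "s \<le> n"
  shows "shanks_term q (Suc n) s - shanks_term q n s = (if s = 0 then 0 else U n (s - 1)) - U n s"
proof -
  have P: "(\<Prod>i\<in>{s<..Suc n}. 1 - q ^ i) = (\<Prod>i\<in>{s<..n}. 1 - q ^ i) * (1 - q ^ Suc n)"
  proof -
    have "{s<..Suc n} = insert (Suc n) {s<..n}" using assms by auto
    then show ?thesis by (simp add: mult.commute)
  qed
  show ?thesis
  proof (cases s)
    case 0
    then show ?thesis unfolding U_def shanks_term_def P by (simp add: algebra_simps)
  next
    case (Suc r)
    let ?A = "\<Prod>i\<in>{s<..n}. 1 - q ^ i" and ?e = "s * n + s * (s + 1) div 2"
    have "{r<..n} = insert s {s<..n}" using assms Suc by auto
    then have Q: "(\<Prod>i\<in>{r<..n}. 1 - q ^ i) = (1 - q ^ s) * ?A" by simp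
    have "s * (s + 1) div 2 = r * (r + 1) div 2 + s" using Suc by simp
    then have e: "r * n + r * (r + 1) div 2 + (r + n + 1) = ?e" using Suc by simp
    have "U n r = (-1) ^ r * ((1 - q ^ s) * ?A) * q ^ ?e"
      unfolding U_def shanks_term_def Q e[symmetric] by (simp add: power_add mult.assoc)
    then have U: "U n r = - ((-1) ^ s * (1 - q ^ s) * ?A * q ^ ?e)"
      using Suc by simp
    have "s * Suc n + s * (s + 1) div 2 = ?e + s" by simp
    then have T': "shanks_term q (Suc n) s = (-1) ^ s * (?A * (1 - q ^ Suc n)) * q ^ ?e * q ^ s"
      unfolding shanks_term_def P by (simp only: power_add mult.assoc)
    have U': "U n s = (-1) ^ s * ?A * q ^ ?e * (q ^ s * q ^ Suc n)"
      unfolding U_def shanks_term_def by (simp add: power_add mult_ac)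
    have T: "shanks_term q n s = (-1) ^ s * ?A * q ^ ?e"
      by (simp add: shanks_term_def)
    \<comment> \<open>With \<open>(-1) ^ s * ?A * q ^ ?e\<close> factored out, both sides are
      \<open>q^s * (1 - q^(n+1)) - 1 = -(1 - q^s) - q^s * q^(n+1)\<close>.\<close>
    have "shanks_term q (Suc n) s - shanks_term q n s = U n r - U n s"
      unfolding T T' U U' by (simp add: algebra_simps)
    then show ?thesis using Suc by simp
  qed
qed

text \<open>Induction on \<open>n\<close>: the differences for \<open>s\<close> up to
  \<open>n\<close> telescope to \<open>- U n\<close>, which is the series term of index
  \<open>-(n+1)\<close>, and the new summand \<open>s = n+1\<close> is the term of index
  \<open>n+1\<close>.\<close>

lemma shanks_identity:
  fixes q :: "'a::comm_ring_1"
  shows "(\<Sum>s\<le>n. shanks_term q n s) = (\<Sum>k=-int n..int n. (-1) ^ nat \<bar>k\<bar> * q ^ pentagonal k)"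
proof (induction n)
  case 0
  then show ?case by (simp add: shanks_term_def pentagonal_def)
next
  case (Suc n)
  define U where "U s = shanks_term q n s * q ^ (s + n + 1)" for s
  have "(\<Sum>s\<le>m. (if s = 0 then 0 else U (s - 1)) - U s) = - U m" for m
    by (induction m) auto
  then have "(\<Sum>s\<le>n. shanks_term q (Suc n) s) - (\<Sum>s\<le>n. shanks_term q n s) = - U n"
    unfolding sum_subtractf[symmetric] U_def
    by (subst sum.cong[OF refl shanks_term_diff]) auto
  moreover have "shanks_term q (Suc n) (Suc n) = (-1) ^ Suc n * q ^ pentagonal (int (Suc n))"
    by (simp add: shanks_term_def pentagonal_of_nat del: of_nat_Suc)
  moreover have "- U n = (-1) ^ Suc n * q ^ pentagonal (- int (Suc n))"
  proof -
    have "pentagonal (- int (Suc n)) + Suc n = Suc n * Suc n + Suc n * (Suc n + 1) div 2"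
      using pentagonal_minus[of "Suc n"] pentagonal_of_nat[of "Suc n"] by simp
    then have "pentagonal (- int (Suc n)) = n * n + n * (n + 1) div 2 + (n + n + 1)"
      by simp
    then show ?thesis
      by (simp add: U_def shanks_term_def power_add)
  qed
  moreover have "{- int (Suc n)..int (Suc n)} = insert (int (Suc n)) (insert (- int (Suc n)) {- int n..int n})"
    by auto
  ultimately show ?case using Suc by (simp add: algebra_simps del: of_nat_Suc)
qed

text \<open>A general \<open>q\<close> without constant term covers both \<open>- fps_X\<close> and
  \<open>fps_X ^ 4\<close>; its power \<open>q^e\<close> has no coefficients below degree
  \<open>e\<close>.\<close>

lemma pentagonal_number_theorem:
  assumes "fps_nth q 0 = 0"
  shows "fps_cong N m (\<Prod>i=1..N. 1 - q ^ i) (\<Sum>k=-int N..int N. (-1) ^ nat \<bar>k\<bar> * q ^ pentagonal k)"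
proof -
  have "fps_nth (shanks_term q N s) n = 0" if "s > 0" "n \<le> N" for s n
  proof -
    have "N < s * N + s * (s + 1) div 2"
    proof -
      have "s * (s + 1) div 2 \<ge> 1" using that by (cases s) auto
      moreover have "1 * N \<le> s * N" using that by (intro mult_right_mono) auto
      ultimately show ?thesis by linarith
    qed
    then have "fps_nth (q ^ (s * N + s * (s + 1) div 2)) i = 0" if "i \<le> N" for i
      using that assms by (intro startsby_zero_power_prefix[rule_format]) auto
    then show ?thesis using that
      unfolding shanks_term_def fps_mult_nth[of _ "_ ^ (s * N + _)"] by (intro sum.neutral) auto
  qed
  then have "fps_nth (\<Sum>s\<le>N. shanks_term q N s) n = fps_nth (shanks_term q N 0) n" if "n \<le> N" for n
    using that by (simp add: fps_sum_nth sum.remove[of "{..N}" 0])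
  moreover have "shanks_term q N 0 = (\<Prod>i=1..N. 1 - q ^ i)"
    by (auto simp: shanks_term_def intro!: prod.cong)
  ultimately show ?thesis by (simp add: fps_cong_def shanks_identity)
qed

section \<open>The generating function of 6-regular partitions modulo 3\<close>

lemma b6_eq_partitions_fps:
  assumes "n \<le> N"
  shows "int (b6 (int n)) = fps_nth (partitions_fps {i\<in>{1..N}. \<not> 6 dvd i}) n"
proof -
  have "k \<le> \<Sum>\<^sub># M" if "k \<in># M" for k :: nat and M
    using that by (metis le_add1 sum_mset.remove)
  then have "regular_partitions 6 n = partitions_in {i\<in>{1..N}. \<not> 6 dvd i} n"
    using assms by (fastforce simp: regular_partitions_def partitions_in_def Suc_le_eq)
  then show ?thesis by (simp add: b6_def partitions_fps_def)
qed

text \<open>Splitting indices by parity gives $f_1 = f_2 O$, $f_1(-q) = f_2 G$ and $f_2 = f_4 O G$,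
  where $O$ and $G$ are the products of $1 - q^i$ and $1 + q^i$ over odd $i$. Below,
  \<open>F (D k)\<close> is the truncation of $f_k$ to indices up to \<open>N\<close>.\<close>

lemma partitions_fps_6_regular_cong:
  "fps_cong N 3 (partitions_fps {i\<in>{1..N}. \<not> 6 dvd i})
     ((\<Prod>i=1..N. 1 - (- fps_X) ^ i) * (\<Prod>i=1..N. 1 - (fps_X ^ 4) ^ i))"
proof -
  define F where "F S = (\<Prod>i\<in>S. 1 - fps_X ^ i :: int fps)" for S
  define D where "D k = {i\<in>{1..N}. k dvd i}" for k
  define A where "A = {i\<in>{1..N}. \<not> 6 dvd i}"
  define odds where "odds = {i\<in>{1..N}. odd i}"
  define G where "G = (\<Prod>i\<in>odds. 1 + fps_X ^ i :: int fps)"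
  have fin [simp]: "finite (D k)" "finite A" "finite odds" for k
    by (auto simp: D_def A_def odds_def)
  have image: "(\<Prod>i\<in>S. 1 - fps_X ^ (k * i)) = F ((*) k ` S)" if "k > 0" for k S
    unfolding F_def using that by (subst prod.reindex) (auto simp: inj_on_def)
  have cong: "fps_cong N 3 (F S) (F T)"
    if "finite S" "finite T" "\<And>i. i \<le> N \<Longrightarrow> i \<in> S \<longleftrightarrow> i \<in> T" for S T
    unfolding F_def by (rule fps_cong_prod_one_minus) (use that in auto)
  have union: "F (S \<union> T) = F S * F T" if "finite S" "finite T" "S \<inter> T = {}" for S T
    unfolding F_def using that by (rule prod.union_disjoint)

  have "A \<union> D 6 = D 1" by (auto simp: A_def D_def)
  then have A_D6: "F A * F (D 6) = F (D 1)"
    by (subst union[symmetric]) (auto simp: A_def D_def)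
  have D2_odds: "F (D 2) * F odds = F (D 1)"
    by (subst union[symmetric]) (auto simp: odds_def D_def intro: arg_cong[of _ _ F])

  \<comment> \<open>Tripling the members of \<open>D 2\<close> gives all multiples of 6 up to
    \<open>N\<close>, and some beyond \<open>N\<close> that the truncation ignores.\<close>
  have D6: "fps_cong N 3 (F (D 6)) (F (D 2) ^ 3)"
  proof -
    have "fps_cong N 3 (F (D 6)) (F ((*) 3 ` D 2))"
    proof (rule cong)
      fix i assume "i \<le> N"
      show "i \<in> D 6 \<longleftrightarrow> i \<in> (*) 3 ` D 2"
      proof
        assume "i \<in> D 6"
        then obtain c where "i = 3 * (2 * c)" "i > 0" by (auto simp: D_def elim!: dvdE)
        then show "i \<in> (*) 3 ` D 2" using \<open>i \<le> N\<close> by (auto simp: D_def)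
      qed (use \<open>i \<le> N\<close> in \<open>auto simp: D_def elim!: dvdE\<close>)
    qed auto
    also have "F ((*) 3 ` D 2) = (\<Prod>i\<in>D 2. 1 - fps_X ^ (3 * i))"
      by (simp add: image)
    also have "fps_cong N 3 \<dots> (\<Prod>i\<in>D 2. (1 - fps_X ^ i) ^ 3)"
      by (intro fps_cong_prod fps_cong_sym[OF fps_cong_cube_one_minus])
    also have "\<dots> = F (D 2) ^ 3" by (simp add: F_def prod_power_distrib)
    finally show ?thesis .
  qed

  \<comment> \<open>Every even index is a multiple of 4 or twice an odd number; the latter come from
    \<open>(1 - X^i) * (1 + X^i) = 1 - X^(2*i)\<close>.\<close>
  have D2: "fps_cong N 3 (F (D 2)) (F (D 4) * (F odds * G))"
  proof -
    have "F odds * G = (\<Prod>i\<in>odds. 1 - fps_X ^ (2 * i))"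
      unfolding F_def G_def prod.distrib[symmetric]
      by (intro prod.cong) (auto simp: algebra_simps power_mult power2_eq_square mult_2 power_add)
    also have "\<dots> = F ((*) 2 ` odds)" by (simp add: image)
    also have "F (D 4) * \<dots> = F (D 4 \<union> (*) 2 ` odds)"
    proof -
      have "even c" if "4 dvd 2 * c" for c :: nat using that by presburger
      then have "D 4 \<inter> (*) 2 ` odds = {}" by (auto simp: D_def odds_def)
      then show ?thesis by (simp add: union)
    qed
    also have "fps_cong N 3 (F (D 2)) \<dots>"
    proof (rule cong)
      fix i assume "i \<le> N"
      show "i \<in> D 2 \<longleftrightarrow> i \<in> D 4 \<union> (*) 2 ` odds"
      proof
        assume "i \<in> D 2"
        then obtain c where c: "i = 2 * c" "i > 0" by (auto simp: D_def elim!: dvdE)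
        then show "i \<in> D 4 \<union> (*) 2 ` odds" using \<open>i \<le> N\<close>
          by (cases "even c") (auto simp: D_def odds_def elim!: evenE)
      next
        assume "i \<in> D 4 \<union> (*) 2 ` odds"
        then show "i \<in> D 2" using \<open>i \<le> N\<close> by (auto simp: D_def odds_def elim!: dvdE)
      qed
    qed auto
    finally show ?thesis .
  qed

  have neg: "(\<Prod>i=1..N. 1 - (- fps_X) ^ i) = F (D 2) * G"
  proof -
    have "{1..N} = D 2 \<union> odds" by (auto simp: D_def odds_def)
    then have "(\<Prod>i=1..N. 1 - (- fps_X :: int fps) ^ i)
        = (\<Prod>i\<in>D 2. 1 - (- fps_X) ^ i) * (\<Prod>i\<in>odds. 1 - (- fps_X) ^ i)"
      by (simp only:) (intro prod.union_disjoint, auto simp: D_def odds_def)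
    also have "(\<Prod>i\<in>D 2. 1 - (- fps_X :: int fps) ^ i) = F (D 2)"
      unfolding F_def by (intro prod.cong) (auto simp: D_def)
    also have "(\<Prod>i\<in>odds. 1 - (- fps_X :: int fps) ^ i) = G"
      unfolding G_def by (intro prod.cong) (auto simp: odds_def)
    finally show ?thesis .
  qed

  have D4: "fps_cong N 3 (F (D 4)) (\<Prod>i=1..N. 1 - (fps_X ^ 4) ^ i)"
  proof -
    have "(\<Prod>i=1..N. 1 - (fps_X ^ 4 :: int fps) ^ i) = F ((*) 4 ` {1..N})"
      by (subst image[symmetric]) (simp_all add: power_mult)
    moreover have "fps_cong N 3 (F (D 4)) (F ((*) 4 ` {1..N}))"
      by (rule cong) (auto simp: D_def elim!: dvdE)
    ultimately show ?thesis by simp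
  qed

  define B where "B = partitions_fps A"
  define C where "C = partitions_fps (D 1)"
  have B: "B * F A = 1" unfolding B_def F_def
    by (rule partitions_fps_mult) (auto simp: A_def)
  have C: "C * F (D 1) = 1" unfolding C_def F_def
    by (rule partitions_fps_mult) (auto simp: D_def)
  \<comment> \<open>\<open>C\<close> inverts $f_1$ and so allows cancelling it without division.\<close>
  have "B = C * (B * F (D 1))" using C by (simp add: mult.left_commute)
  also have "B * F (D 1) = F (D 6)" using B A_D6 by (metis mult.assoc mult_1)
  also have "fps_cong N 3 (C * \<dots>) (C * F (D 2) ^ 3)"
    by (intro fps_cong_mult fps_cong_refl D6)
  also have "C * F (D 2) ^ 3 = C * (F (D 2) * F (D 2) * F (D 2))"
    by (simp add: power3_eq_cube)
  \<comment> \<open>Only one of the three factors is expanded: its \<open>F odds\<close> joins a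
    second factor to form \<open>F (D 1)\<close>, which \<open>C\<close> cancels, and its
    \<open>G\<close> joins the third to form $f_1(-q)$.\<close>
  also have "fps_cong N 3 \<dots> (C * (F (D 2) * F (D 2) * (F (D 4) * (F odds * G))))"
    by (intro fps_cong_mult fps_cong_refl D2)
  also have "\<dots> = (C * F (D 1)) * ((F (D 2) * G) * F (D 4))"
    by (simp only: D2_odds[symmetric] mult_ac)
  also have "\<dots> = (F (D 2) * G) * F (D 4)" by (simp only: C mult_1)
  also have "fps_cong N 3 \<dots> ((F (D 2) * G) * (\<Prod>i=1..N. 1 - (fps_X ^ 4) ^ i))"
    by (intro fps_cong_mult fps_cong_refl D4)
  finally show ?thesis unfolding neg B_def A_def .
qed

lemma b6_not_cong_0_imp:
  assumes "\<not> [int (b6 (int n)) = 0] (mod 3)"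
  obtains x y where "24 * int n + 5 = x\<^sup>2 + y\<^sup>2"
proof -
  let ?S = "\<lambda>q :: int fps. \<Sum>k=-int n..int n. (-1) ^ nat \<bar>k\<bar> * q ^ pentagonal k"
  have "fps_cong n 3 (partitions_fps {i\<in>{1..n}. \<not> 6 dvd i})
      ((\<Prod>i=1..n. 1 - (- fps_X) ^ i) * (\<Prod>i=1..n. 1 - (fps_X ^ 4) ^ i))"
    by (rule partitions_fps_6_regular_cong)
  also have "fps_cong n 3 \<dots> (?S (- fps_X) * ?S (fps_X ^ 4))"
    by (intro fps_cong_mult pentagonal_number_theorem) auto
  finally have "[int (b6 (int n)) = fps_nth (?S (- fps_X) * ?S (fps_X ^ 4)) n] (mod 3)"
    unfolding b6_eq_partitions_fps[OF order_refl] fps_cong_def by blast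
  then have "fps_nth (?S (- fps_X) * ?S (fps_X ^ 4)) n \<noteq> 0"
    using assms by metis
  then obtain k l where
    "fps_nth (((-1) ^ nat \<bar>k\<bar> * (- fps_X) ^ pentagonal k) *
              ((-1) ^ nat \<bar>l\<bar> * (fps_X ^ 4) ^ pentagonal l) :: int fps) n \<noteq> 0"
    unfolding sum_product fps_sum_nth by (meson sum.not_neutral_contains_not_neutral)
  \<comment> \<open>Each product of two terms is a monomial, so its coefficient at \<open>n\<close>
    vanishes unless \<open>n\<close> is its exponent.\<close>
  also have "((-1) ^ nat \<bar>k\<bar> * (- fps_X) ^ pentagonal k) *
              ((-1) ^ nat \<bar>l\<bar> * (fps_X ^ 4) ^ pentagonal l)
      = fps_const ((-1) ^ nat \<bar>k\<bar> * (-1) ^ pentagonal k * (-1) ^ nat \<bar>l\<bar>)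
          * (fps_X ^ (pentagonal k + 4 * pentagonal l) :: int fps)"
    by (subst power_minus[of fps_X])
       (simp add: power_add power_mult[symmetric] mult_ac fps_const_power[symmetric] fps_const_neg[symmetric]
         fps_const_mult[symmetric] del: fps_const_power fps_const_neg fps_const_mult)
  finally have "n = pentagonal k + 4 * pentagonal l"
    by (auto split: if_splits)
  \<comment> \<open>The constant 5 splits as 1 + 4: the sum is
    \<open>(24 * pentagonal k + 1) + 4 * (24 * pentagonal l + 1)\<close>.\<close>
  then have "24 * int n + 5 = (6 * k + 1)\<^sup>2 + (2 * (6 * l + 1))\<^sup>2"
    unfolding power_mult_distrib pentagonal_eq[symmetric] by simp
  then show thesis by (rule that)
qed

section \<open>Sums of two squares\<close>

text \<open>Otherwise \<open>p\<close> divides neither \<open>x\<close> nor \<open>y\<close>.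
  Raising \<open>x^2 = -y^2\<close> modulo \<open>p\<close> to the power \<open>(p-1)/2\<close>,
  which is odd, gives \<open>1 = -1\<close> by Fermat, impossible for \<open>p > 2\<close>.\<close>

lemma prime_3_mod_4_dvd_sum_squares:
  fixes p x y :: int
  assumes "prime p" "[p = 3] (mod 4)" "p dvd x\<^sup>2 + y\<^sup>2"
  shows "p dvd x"
proof (rule ccontr)
  assume x: "\<not> p dvd x"
  have y: "\<not> p dvd y"
  proof
    assume "p dvd y"
    then have "p dvd x\<^sup>2 + y\<^sup>2 - y\<^sup>2" using assms(3) by (intro dvd_diff) (auto simp: power2_eq_square)
    then show False using x assms(1) by (simp add: prime_dvd_power_iff)
  qed
  have p: "p > 2" using assms(1,2) prime_ge_2_int[of p] by (cases "p = 2") (auto simp: cong_def)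
  define k where "k = nat (p div 4)"
  have "p = 4 * int k + 3"
    using assms(2) p mult_div_mod_eq[of 4 p] by (simp add: k_def cong_def)
  then have pk: "nat p - 1 = 2 * (2 * k + 1)" by simp
  have fermat: "[z ^ (nat p - 1) = 1] (mod p)" if "\<not> p dvd z" for z
  proof -
    \<comment> \<open>Fermat's theorem is applied over the naturals, so \<open>z\<close>, possibly
      negative, is first reduced to its residue.\<close>
    have "[nat (z mod p) ^ (nat p - 1) = 1] (mod nat p)"
    proof (rule fermat_theorem)
      show "prime (nat p)" using assms(1) by simp
      show "\<not> nat p dvd nat (z mod p)"
        using that p by (simp add: nat_dvd_iff dvd_mod_iff)
    qed
    then have "[int (nat (z mod p)) ^ (nat p - 1) = 1] (mod int (nat p))"
      by (metis cong_int_iff of_nat_1 of_nat_power)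
    then have "[(z mod p) ^ (nat p - 1) = 1] (mod p)" using p by simp
    then show ?thesis by (simp add: cong_def power_mod)
  qed
  have "[x\<^sup>2 = - (y\<^sup>2)] (mod p)" using assms(3) by (simp add: cong_iff_dvd_diff)
  then have "[(x\<^sup>2) ^ (2 * k + 1) = (- (y\<^sup>2)) ^ (2 * k + 1)] (mod p)" by (rule cong_pow)
  then have "[x ^ (nat p - 1) = - (y ^ (nat p - 1))] (mod p)"
    unfolding pk power_mult by simp
  then have "[1 = - (1::int)] (mod p)"
    using fermat[OF x] fermat[OF y] by (metis cong_minus_minus_iff cong_sym cong_trans)
  then have "p dvd 2" by (simp add: cong_iff_dvd_diff)
  then show False using p zdvd_imp_le by fastforce
qed

text \<open>Infinite descent on the absolute value of \<open>m\<close>: \<open>p\<close> divides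
  \<open>x\<close> and \<open>y\<close>, so \<open>p^2\<close> divides the left side, and
  \<open>p\<close> divides \<open>m\<close> because it does not divide \<open>c\<close>. Cancelling
  \<open>p^2\<close> leaves a smaller solution.\<close>

lemma sum_squares_neq_prime_times_square:
  fixes p m c x y :: int
  assumes "prime p" "[p = 3] (mod 4)" "\<not> p dvd c" "m \<noteq> 0"
  shows "x\<^sup>2 + y\<^sup>2 \<noteq> p * m\<^sup>2 * c"
  using assms(4)
proof (induction "nat \<bar>m\<bar>" arbitrary: m x y rule: less_induct)
  case less
  show ?case
  proof
    assume eq: "x\<^sup>2 + y\<^sup>2 = p * m\<^sup>2 * c"
    have "p dvd x" "p dvd y"
      using prime_3_mod_4_dvd_sum_squares[OF assms(1,2), of x y]
        prime_3_mod_4_dvd_sum_squares[OF assms(1,2), of y x] eq by (auto simp: add.commute)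
    then obtain x' y' where xy: "x = p * x'" "y = p * y'" by (auto elim!: dvdE)
    have p: "p \<ge> 2" using assms(1) by (rule prime_ge_2_int)
    have "p * (p * (x'\<^sup>2 + y'\<^sup>2)) = p * (m\<^sup>2 * c)"
      using eq unfolding xy by (simp add: power2_eq_square algebra_simps)
    then have eq': "p * (x'\<^sup>2 + y'\<^sup>2) = m\<^sup>2 * c" using p by simp
    then have "p dvd m\<^sup>2 * c" by (metis dvd_triv_left)
    then have "p dvd m" using assms(1,3) by (simp add: prime_dvd_mult_iff prime_dvd_power_iff)
    then obtain m' where m: "m = p * m'" by (auto elim!: dvdE)
    have "p * (x'\<^sup>2 + y'\<^sup>2) = p * (p * m'\<^sup>2 * c)"
      using eq' unfolding m by (simp add: power2_eq_square algebra_simps)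
    then have "x'\<^sup>2 + y'\<^sup>2 = p * m'\<^sup>2 * c" using p by simp
    moreover have "m' \<noteq> 0" using less.prems m by auto
    moreover have "nat \<bar>m'\<bar> < nat \<bar>m\<bar>"
    proof -
      have "1 * \<bar>m'\<bar> < p * \<bar>m'\<bar>" using p \<open>m' \<noteq> 0\<close> by (intro mult_strict_right_mono) auto
      then show ?thesis using p by (simp add: m abs_mult)
    qed
    ultimately show False using less.hyps by blast
  qed
qed

theorem theorem1p1:
  fixes \<alpha> :: nat and p :: "nat \<Rightarrow> int" and j n :: int
  assumes "\<And>i. i \<in> {1..\<alpha> + 1} \<Longrightarrow> prime (p i) \<and> p i \<ge> 5"
    and "[p (\<alpha> + 1) = 3] (mod 4)"
    and "\<not> [j = 0] (mod p (\<alpha> + 1))"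
    and "n \<ge> 0"
  shows "[b6 ((\<Prod>i = 1..\<alpha> + 1. (p i)\<^sup>2) * n
            + ((\<Prod>i = 1..\<alpha>. (p i)\<^sup>2) * p (\<alpha> + 1) * (24 * j + 5 * p (\<alpha> + 1)) - 5) div 24)
          = 0] (mod 3)"
proof -
  define r where "r = p (\<alpha> + 1)"
  define m where "m = (\<Prod>i = 1..\<alpha>. p i)"
  define a where "a = m\<^sup>2 * r\<^sup>2 * n + (m\<^sup>2 * r * (24 * j + 5 * r) - 5) div 24"
  have r: "prime r" "r \<ge> 5" using assms(1)[of "\<alpha> + 1"] by (auto simp: r_def)
  have m2: "(\<Prod>i = 1..\<alpha>. (p i)\<^sup>2) = m\<^sup>2" by (simp add: m_def prod_power_distrib)
  have "m \<noteq> 0" using assms(1) by (fastforce simp: m_def)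
  have "24 dvd m\<^sup>2 * r * (24 * j + 5 * r) - 5"
    using dvd_24_argument[of \<alpha> p j, OF assms(1)] by (simp only: m2 r_def)
  \<comment> \<open>Exact division by 24 yields the shape \<open>p * m^2 * c\<close> of the descent
    lemma, with \<open>c\<close> congruent to \<open>24 * j\<close> modulo \<open>r\<close>.\<close>
  then have "24 * a + 5 = r * m\<^sup>2 * (24 * (r * n + j) + 5 * r)"
    unfolding a_def by (simp add: algebra_simps power2_eq_square)
  moreover have "\<not> r dvd 24 * (r * n + j) + 5 * r"
  proof
    assume "r dvd 24 * (r * n + j) + 5 * r"
    then have "r dvd (24 * (r * n + j) + 5 * r) - r * (24 * n + 5)" by (intro dvd_diff) auto
    then have "r dvd 24 * j" by (simp add: algebra_simps)
    moreover have "\<not> r dvd j" using assms(3) by (simp add: r_def cong_0_iff)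
    moreover have "\<not> r dvd 24"
    proof
      assume "r dvd 24"
      then have "r dvd 2 ^ 3 * 3" by simp
      then have "r dvd 2 \<or> r dvd 3"
        using r(1) by (metis prime_dvd_mult_iff prime_dvd_power)
      then show False using r(2) zdvd_imp_le by fastforce
    qed
    ultimately show False using r(1) by (simp add: prime_dvd_mult_iff)
  qed
  ultimately have no: "x\<^sup>2 + y\<^sup>2 \<noteq> 24 * a + 5" for x y
    using sum_squares_neq_prime_times_square[OF r(1) _ _ \<open>m \<noteq> 0\<close>] assms(2) by (simp add: r_def)
  have "[b6 a = 0] (mod 3)"
  \<comment> \<open>A negative \<open>j\<close> can make \<open>a\<close> negative, where
    \<open>b6\<close> is 0 by convention.\<close>
  proof (cases "a < 0")
    case True
    then show ?thesis by (simp add: b6_def)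
  next
    case False
    then have "[int (b6 a) = 0] (mod 3)"
      using b6_not_cong_0_imp[of "nat a"] no by (metis int_nat_eq linorder_not_less)
    then show ?thesis by (simp flip: cong_int_iff)
  qed
  then show ?thesis
    unfolding a_def m2[symmetric] r_def by (simp add: mult.assoc)
qed

end
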